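(* For every real $\epsilon>0$ there exists a constant $c(\epsilon)>0$, depending only on $\epsilon$, such that the following holds. Let $\alpha,\beta$ be real numbers in $(0,1]$, let $X,Y$ be real numbers $\geq 1$, and let $A$ and $B$ be subsets of the integers in $[1,X]$ and $[1,Y]$ respectively, with $|A|\geq \alpha X$ and $|B|\geq \beta Y$. Then $$|A/B| \;\geq\; c(\epsilon)\,(\alpha\beta)^{1+\epsilon}\,XY .$$
   Context: For subsets $A$ and $B$ of the integers $\geq 1$, $A/B$ denotes the subset of $\mathbf{Q}$ consisting of all rational numbers expressible as $a/b$ with $(a,b)\in A\times B$ (each rational number is counted once). $|\cdot|$ denotes cardinality. *)

theory Defs
  imports Complex_Main
begin

text \<open>The set \<open>A/B\<close> of rational numbers \<open>a/b\<close>. It is a set of rationals, so its cardinality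
  counts each quotient once. For \<open>0 \<in> B\<close> it would contain the HOL value \<open>a/0 = 0\<close>; it is meant for
  sets of positive integers only.\<close>

definition quotient_set :: "nat set \<Rightarrow> nat set \<Rightarrow> rat set" where
  "quotient_set A B = {of_nat a / of_nat b | a b. a \<in> A \<and> b \<in> B}"

end

theory Submission
  imports Defs "HOL-Analysis.Convex" "HOL-Analysis.Harmonic_Numbers"
begin

text \<open>Sort the pairs \<open>(a, b) \<in> A \<times> B\<close> by \<open>d = gcd a b\<close>. Pairs in one fibre have distinct quotients,
  so with \<open>K = |A/B|\<close> every fibre has at most \<open>K\<close> elements. Let \<open>\<delta>\<close> be the density of \<open>A \<times> B\<close>.
  At most \<open>X Y / D\<close> pairs have gcd above \<open>D\<close>, so for \<open>D\<close> of order \<open>1 / \<delta>\<close> the fibres with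
  \<open>d \<le> D\<close> already contain half of \<open>A \<times> B\<close>. Averaging over these \<open>D\<close> fibres would only give
  a lower bound of order \<open>\<delta>\<^sup>2 X Y\<close>; the product structure improves on this.

  Write \<open>A\<^sub>d\<close> for the set of multiples of \<open>d\<close> in \<open>A\<close>. The fibre over \<open>d\<close> lies in
  \<open>A\<^sub>d \<times> B\<^sub>d\<close>, so its size is at most the geometric mean of \<open>K\<close> and \<open>|A\<^sub>d| |B\<^sub>d|\<close>. By
  Cauchy--Schwarz the sum of the fibre sizes over \<open>d \<le> D\<close> is at most
  \<open>sqrt (K (\<Sum>d. |A\<^sub>d|) (\<Sum>d. |B\<^sub>d|))\<close>. Now \<open>\<Sum>d. |A\<^sub>d|\<close> is the sum over \<open>a \<in> A\<close> of the number of
  divisors of \<open>a\<close> that are at most \<open>D\<close>. The \<open>k\<close>-th moment of this truncated divisor function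
  over all \<open>n \<le> X\<close> is at most \<open>X\<close> times a power of \<open>log D\<close>
  (\<open>sum_card_small_divisors_power_le\<close>), so by convexity \<open>\<Sum>d. |A\<^sub>d|\<close> exceeds \<open>|A|\<close> by a factor of
  at most \<open>(|A| / X) powr (-1/k)\<close>, up to logarithms of \<open>1 / \<delta>\<close>.

  Together this says that \<open>K\<close> is at least a constant times \<open>\<delta> powr (1 + 2/k) X Y\<close>
  (\<open>card_quotient_set_power_ge\<close>, written without roots); choosing \<open>k \<ge> 2 / \<epsilon>\<close> finishes the proof.\<close>

section \<open>Moments of the truncated divisor function\<close>

definition small_divisors :: "nat \<Rightarrow> nat \<Rightarrow> nat set" where
  "small_divisors D n = {d \<in> {1..D}. d dvd n}"

lemma finite_small_divisors [simp]: "finite (small_divisors D n)"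
  by (simp add: small_divisors_def)

text \<open>A divisor of \<open>m * n\<close> splits into a divisor of \<open>m\<close> and a divisor of \<open>n\<close>, and both factors
  inherit the bound \<open>D\<close>. This submultiplicativity is what makes the moments computable by
  induction on the exponent.\<close>

lemma card_small_divisors_mult_le:
  "card (small_divisors D (m * n)) \<le> card (small_divisors D m) * card (small_divisors D n)"
proof -
  have "small_divisors D (m * n)
      \<subseteq> (\<lambda>(x, y). x * y) ` (small_divisors D m \<times> small_divisors D n)"
  proof
    fix d assume "d \<in> small_divisors D (m * n)"
    then have d: "1 \<le> d" "d \<le> D" "d dvd m * n"
      by (auto simp: small_divisors_def)
    then obtain x y where xy: "d = x * y" "x dvd m" "y dvd n"
      using division_decomp by blast
    have pos: "1 \<le> x" "1 \<le> y"
      using d xy(1) by (auto intro: Suc_leI gr0I)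
    then have "x \<le> x * y" "y \<le> x * y"
      by simp_all
    then have "x \<le> D" "y \<le> D"
      using d xy(1) by linarith+
    then have "(x, y) \<in> small_divisors D m \<times> small_divisors D n"
      using xy pos by (auto simp: small_divisors_def)
    then show "d \<in> (\<lambda>(x, y). x * y) ` (small_divisors D m \<times> small_divisors D n)"
      using xy(1) by force
  qed
  then have "card (small_divisors D (m * n))
      \<le> card (small_divisors D m \<times> small_divisors D n)"
    by (rule surj_card_le[rotated]) simp
  then show ?thesis
    by (simp add: card_cartesian_product)
qed

text \<open>Each small divisor \<open>d\<close> of \<open>n\<close> is counted separately, with \<open>n = d * m\<close>. Applied to \<open>f\<close> equal to
  a power of the divisor count, this trades one factor of that power for a sum over \<open>d\<close>.\<close>

lemma sum_card_small_divisors: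
  fixes f :: "nat \<Rightarrow> real"
  shows "(\<Sum>n=1..N. real (card (small_divisors D n)) * f n)
       = (\<Sum>d=1..D. \<Sum>m=1..N div d. f (d * m))"
proof -
  have "(\<Sum>n=1..N. real (card (small_divisors D n)) * f n)
      = (\<Sum>n=1..N. \<Sum>d\<in>{d \<in> {1..D}. d dvd n}. f n)"
    by (simp add: small_divisors_def)
  also have "\<dots> = (\<Sum>d=1..D. \<Sum>n\<in>{n \<in> {1..N}. d dvd n}. f n)"
    by (rule sum.swap_restrict) auto
  also have "\<dots> = (\<Sum>d=1..D. \<Sum>m=1..N div d. f (d * m))"
  proof (rule sum.cong[OF refl])
    fix d assume "d \<in> {1..D}"
    then have d: "d > 0" by simp
    show "(\<Sum>n\<in>{n \<in> {1..N}. d dvd n}. f n) = (\<Sum>m=1..N div d. f (d * m))"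
      by (rule sum.reindex_bij_witness[where i = "\<lambda>m. d * m" and j = "\<lambda>n. n div d"])
        (use d in \<open>auto simp: div_le_mono less_eq_div_iff_mult_less_eq mult.commute
           intro: Suc_leI elim!: dvdE\<close>)
  qed
  finally show ?thesis .
qed

text \<open>Splitting off one factor and using submultiplicativity bounds the logarithmic moment of order
  \<open>k + 1\<close> by the square of that of order \<open>k\<close>; the moment of order \<open>0\<close> is \<open>harm D\<close>.\<close>

lemma sum_card_small_divisors_power_over_le:
  "(\<Sum>n=1..D. real (card (small_divisors D n)) ^ k / real n) \<le> harm D ^ (2 ^ k)"
proof (induction k)
  case 0
  show ?case by (simp add: harm_def field_simps)
next
  case (Suc k)
  define t where "t n = real (card (small_divisors D n))" for n
  define S where "S = (\<Sum>n=1..D. t n ^ k / real n)"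
  have S: "0 \<le> S"
    unfolding S_def t_def by (intro sum_nonneg) simp
  have "(\<Sum>n=1..D. t n ^ Suc k / real n) = (\<Sum>n=1..D. t n * (t n ^ k / real n))"
    by simp
  also have "\<dots> = (\<Sum>d=1..D. \<Sum>m=1..D div d. t (d * m) ^ k / real (d * m))"
    unfolding t_def by (rule sum_card_small_divisors)
  also have "\<dots> \<le> (\<Sum>d=1..D. \<Sum>m=1..D. (t d ^ k / real d) * (t m ^ k / real m))"
  proof (rule sum_mono)
    fix d
    have "(\<Sum>m=1..D div d. t (d * m) ^ k / real (d * m))
        \<le> (\<Sum>m=1..D div d. (t d ^ k / real d) * (t m ^ k / real m))"
    proof (rule sum_mono)
      fix m
      have "t (d * m) \<le> t d * t m"
        unfolding t_def by (metis card_small_divisors_mult_le of_nat_le_iff of_nat_mult)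
      then have "t (d * m) ^ k \<le> (t d * t m) ^ k"
        by (rule power_mono) (simp add: t_def)
      then show "t (d * m) ^ k / real (d * m) \<le> (t d ^ k / real d) * (t m ^ k / real m)"
        by (simp add: power_mult_distrib divide_right_mono)
    qed
    also have "\<dots> \<le> (\<Sum>m=1..D. (t d ^ k / real d) * (t m ^ k / real m))"
      by (rule sum_mono2) (auto simp: t_def intro: order_trans[OF _ div_le_dividend])
    finally show "(\<Sum>m=1..D div d. t (d * m) ^ k / real (d * m))
        \<le> (\<Sum>m=1..D. (t d ^ k / real d) * (t m ^ k / real m))" .
  qed
  also have "\<dots> = S * S"
    by (simp add: S_def sum_product)
  also have "\<dots> \<le> harm D ^ (2 ^ k) * harm D ^ (2 ^ k)"
    using Suc.IH S by (intro mult_mono) (auto simp: S_def t_def harm_nonneg)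
  also have "\<dots> = harm D ^ (2 ^ Suc k)"
    by (simp flip: power_add add: mult_2)
  finally show ?case by (simp add: t_def)
qed

text \<open>The crucial feature is that the bound depends on \<open>N\<close> only through the factor \<open>N\<close>: the logarithms
  are those of the truncation point \<open>D\<close>. In the induction the numbers up to \<open>N div d\<close> contribute
  their moment of order \<open>k\<close>, and summing over \<open>d\<close> leaves a logarithmic moment.\<close>

lemma sum_card_small_divisors_power_le:
  "(\<Sum>n=1..N. real (card (small_divisors D n)) ^ k) \<le> real N * harm D ^ (2 ^ k - 1)"
proof (induction k arbitrary: N)
  case 0
  show ?case by simp
next
  case (Suc k)
  define t where "t n = real (card (small_divisors D n))" for n
  have "(\<Sum>n=1..N. t n ^ Suc k) = (\<Sum>d=1..D. \<Sum>m=1..N div d. t (d * m) ^ k)"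
    unfolding t_def power_Suc by (rule sum_card_small_divisors)
  also have "\<dots> \<le> (\<Sum>d=1..D. (t d ^ k / real d) * (real N * harm D ^ (2 ^ k - 1)))"
  proof (rule sum_mono)
    fix d
    have "(\<Sum>m=1..N div d. t (d * m) ^ k) \<le> (\<Sum>m=1..N div d. t d ^ k * t m ^ k)"
    proof (rule sum_mono)
      fix m
      have "t (d * m) \<le> t d * t m"
        unfolding t_def by (metis card_small_divisors_mult_le of_nat_le_iff of_nat_mult)
      then have "t (d * m) ^ k \<le> (t d * t m) ^ k"
        by (rule power_mono) (simp add: t_def)
      then show "t (d * m) ^ k \<le> t d ^ k * t m ^ k"
        by (simp add: power_mult_distrib)
    qed
    also have "\<dots> = t d ^ k * (\<Sum>m=1..N div d. t m ^ k)"
      by (simp add: sum_distrib_left)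
    also have "\<dots> \<le> t d ^ k * (real (N div d) * harm D ^ (2 ^ k - 1))"
      using Suc.IH[of "N div d"] by (intro mult_left_mono) (auto simp: t_def)
    also have "\<dots> \<le> t d ^ k * (real N / real d * harm D ^ (2 ^ k - 1))"
      by (intro mult_left_mono mult_right_mono of_nat_div_le_of_nat)
        (auto simp: t_def harm_nonneg)
    finally show "(\<Sum>m=1..N div d. t (d * m) ^ k)
        \<le> (t d ^ k / real d) * (real N * harm D ^ (2 ^ k - 1))"
      by (simp add: mult_ac)
  qed
  also have "\<dots> = (\<Sum>d=1..D. t d ^ k / real d) * (real N * harm D ^ (2 ^ k - 1))"
    by (simp add: sum_distrib_right)
  also have "\<dots> \<le> harm D ^ (2 ^ k) * (real N * harm D ^ (2 ^ k - 1))"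
    using sum_card_small_divisors_power_over_le[of D k]
    by (intro mult_right_mono) (auto simp: t_def harm_nonneg)
  also have "\<dots> = real N * (harm D ^ (2 ^ k) * harm D ^ (2 ^ k - 1))"
    by simp
  also have "\<dots> = real N * harm D ^ (2 ^ Suc k - 1)"
    by (simp flip: power_add add: mult_2)
  finally show ?case by (simp add: t_def)
qed

section \<open>Multiples in a dense set\<close>

text \<open>The power mean inequality. Even exponents make the power function convex on all reals.\<close>

lemma sum_power_le_card_power_mult_sum_power:
  fixes f :: "'a \<Rightarrow> real"
  assumes "even k" "k > 0"
  shows "(\<Sum>a\<in>A. f a) ^ k \<le> real (card A) ^ (k - 1) * (\<Sum>a\<in>A. f a ^ k)"
proof (cases "finite A \<and> A \<noteq> {}")
  case False
  then show ?thesis using assms by (auto simp: zero_power)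
next
  case True
  define n where "n = real (card A)"
  have n: "n > 0" using True by (simp add: n_def card_gt_0_iff)
  have "(\<Sum>a\<in>A. (1 / n) *\<^sub>R f a) ^ k \<le> (\<Sum>a\<in>A. 1 / n * f a ^ k)"
    using True n
    by (intro convex_on_sum[OF _ _ convex_power_even[OF assms(1)]]) (auto simp: n_def)
  then have "(\<Sum>a\<in>A. f a) ^ k / n ^ k \<le> (\<Sum>a\<in>A. f a ^ k) / n"
    by (simp add: power_divide flip: sum_divide_distrib)
  then have "(\<Sum>a\<in>A. f a) ^ k \<le> (\<Sum>a\<in>A. f a ^ k) / n * n ^ k"
    using n by (simp add: field_simps)
  also have "n ^ k = n * n ^ (k - 1)"
    using assms(2) by (metis Suc_diff_1 power_Suc)
  finally show ?thesis
    using n by (simp add: n_def mult_ac)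
qed

text \<open>The left side sums the truncated divisor function over \<open>A\<close>, by double counting. Its high moments
  over the whole of \<open>{1..N}\<close> are small, so it cannot concentrate on \<open>A\<close>: up to logarithms,
  the sum is at most \<open>|A|\<close> times the \<open>k\<close>-th root of \<open>N / |A|\<close>.\<close>

lemma sum_card_multiples_power_le:
  assumes A: "A \<subseteq> {1..N}" and k: "even k" "k > 0" and D: "D \<ge> 1"
  shows "(\<Sum>d=1..D. real (card {a \<in> A. d dvd a})) ^ k
       \<le> real (card A) ^ (k - 1) * (real N * harm D ^ (2 ^ k))"
proof -
  have fin: "finite A" using A by (rule finite_subset) simp
  have "(\<Sum>d=1..D. real (card {a \<in> A. d dvd a}))
      = (\<Sum>d=1..D. \<Sum>a\<in>{a \<in> A. d dvd a}. 1)"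
    by simp
  also have "\<dots> = (\<Sum>a\<in>A. \<Sum>d\<in>{d \<in> {1..D}. d dvd a}. 1)"
    by (rule sum.swap_restrict) (auto simp: fin)
  also have "\<dots> = (\<Sum>a\<in>A. real (card (small_divisors D a)))"
    by (simp add: small_divisors_def)
  finally have "(\<Sum>d=1..D. real (card {a \<in> A. d dvd a})) ^ k
      = (\<Sum>a\<in>A. real (card (small_divisors D a))) ^ k"
    by simp
  also have "\<dots> \<le> real (card A) ^ (k - 1) * (\<Sum>a\<in>A. real (card (small_divisors D a)) ^ k)"
    by (rule sum_power_le_card_power_mult_sum_power[OF k])
  also have "(\<Sum>a\<in>A. real (card (small_divisors D a)) ^ k)
      \<le> (\<Sum>a=1..N. real (card (small_divisors D a)) ^ k)"
    by (rule sum_mono2) (use A in auto)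
  also have "\<dots> \<le> real N * harm D ^ (2 ^ k - 1)"
    by (rule sum_card_small_divisors_power_le)
  also have "\<dots> \<le> real N * harm D ^ (2 ^ k)"
  proof -
    have "harm 1 \<le> (harm D :: real)" using D by (intro harm_mono)
    then show ?thesis
      by (intro mult_left_mono power_increasing) (simp_all add: harm_expand)
  qed
  finally show ?thesis
    by (simp add: mult_left_mono)
qed

section \<open>Fibres of the greatest common divisor\<close>

text \<open>A fraction is determined by its reduced form, hence a pair by its quotient and its gcd.\<close>

lemma card_gcd_fibre_le_card_quotient_set:
  assumes "finite A" "finite B" "0 \<notin> B"
  shows "card {(a, b) \<in> A \<times> B. gcd a b = d} \<le> card (quotient_set A B)"
proof (rule card_inj_on_le)
  show "inj_on (\<lambda>(a, b). of_nat a / of_nat b :: rat) {(a, b) \<in> A \<times> B. gcd a b = d}"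
  proof (rule inj_onI, clarify)
    fix a b a' b'
    assume *: "a \<in> A" "b \<in> B" "a' \<in> A" "b' \<in> B" "gcd a' b' = gcd a b"
      "(of_nat a / of_nat b :: rat) = of_nat a' / of_nat b'"
    have pos: "b > 0" "b' > 0" using * assms(3) by (auto intro: gr0I)
    then have "(of_nat (a * b') :: rat) = of_nat (a' * b)"
      using * by (simp add: field_simps)
    then have eq: "a * b' = a' * b"
      using of_nat_eq_iff by blast
    \<comment> \<open>Both gcds are equal, so the cross-multiplied equation can be pushed through the gcd.\<close>
    have "a * gcd a b = gcd (a * a') (a * b')"
      by (metis *(5) gcd_mult_distrib_nat)
    also have "\<dots> = a' * gcd a b"
      by (simp add: eq gcd_mult_distrib_nat mult.commute)
    finally have "a = a'" using pos by simp
    then show "a = a' \<and> b = b'"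
      using eq pos * by (cases "a = 0") auto
  qed
  show "(\<lambda>(a, b). of_nat a / of_nat b) ` {(a, b) \<in> A \<times> B. gcd a b = d} \<subseteq> quotient_set A B"
    by (auto simp: quotient_set_def)
  have "quotient_set A B = (\<lambda>(a, b). of_nat a / of_nat b) ` (A \<times> B)"
    by (auto simp: quotient_set_def)
  then show "finite (quotient_set A B)"
    using assms by simp
qed

lemma card_gcd_fibre_le_card_multiples:
  fixes A B :: "nat set"
  assumes "finite A" "finite B"
  shows "card {(a, b) \<in> A \<times> B. gcd a b = d}
       \<le> card {a \<in> A. d dvd a} * card {b \<in> B. d dvd b}"
proof -
  have "{(a, b) \<in> A \<times> B. gcd a b = d} \<subseteq> {a \<in> A. d dvd a} \<times> {b \<in> B. d dvd b}"
    by auto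
  then have "card {(a, b) \<in> A \<times> B. gcd a b = d} \<le> card ({a \<in> A. d dvd a} \<times> {b \<in> B. d dvd b})"
    using assms by (intro card_mono) auto
  then show ?thesis
    by (simp add: card_cartesian_product)
qed

lemma card_multiples_le:
  assumes "A \<subseteq> {1..N}"
  shows "real (card {a \<in> A. d dvd a}) \<le> real N / real d"
proof (cases "d = 0")
  case True
  then have "{a \<in> A. d dvd a} = {}"
    using assms by auto
  then show ?thesis using True by (simp only: card.empty) simp
next
  case False
  have "{a \<in> A. d dvd a} \<subseteq> (\<lambda>m. d * m) ` {1..N div d}"
    using assms False
    by (auto simp: image_iff less_eq_div_iff_mult_less_eq mult.commute intro: Suc_leI elim!: dvdE)
  then have "card {a \<in> A. d dvd a} \<le> N div d"
    using surj_card_le[of "{1..N div d}" "{a \<in> A. d dvd a}"] by simp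
  then show ?thesis
    using of_nat_div_le_of_nat order_trans of_nat_le_iff by metis
qed

lemma sum_inverse_squares_tail_le:
  assumes "1 \<le> D"
  shows "(\<Sum>d\<in>{D<..N}. 1 / (real d)\<^sup>2) \<le> 1 / real D"
proof (cases "D \<le> N")
  case True
  then have "(\<Sum>d\<in>{D<..N}. 1 / (real d)\<^sup>2) \<le> 1 / real D - 1 / real N"
  proof (induction N rule: dec_induct)
    case base
    show ?case by simp
  next
    case (step n)
    have n: "real n > 0" using step assms by simp
    have "{D<..Suc n} = insert (Suc n) {D<..n}" using step by auto
    then have "(\<Sum>d\<in>{D<..Suc n}. 1 / (real d)\<^sup>2)
        \<le> 1 / (real (Suc n))\<^sup>2 + (1 / real D - 1 / real n)"
      using step by simp
    also have "1 / (real (Suc n))\<^sup>2 \<le> 1 / real n - 1 / real (Suc n)"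
      using n by (simp add: divide_simps power2_eq_square)
    finally show ?case by simp
  qed
  also have "\<dots> \<le> 1 / real D" by simp
  finally show ?thesis .
qed simp

text \<open>The pairs of multiples of \<open>d\<close> number at most \<open>N * M / d\<^sup>2\<close>, and the tail of \<open>1 / d\<^sup>2\<close> beyond
  \<open>D\<close> is at most \<open>1 / D\<close>. So gcds above \<open>D\<close> account for few pairs.\<close>

lemma card_product_le_sum_card_gcd_fibres:
  assumes A: "A \<subseteq> {1..N}" and B: "B \<subseteq> {1..M}" and D: "1 \<le> D"
  shows "real (card A * card B)
       \<le> (\<Sum>d=1..D. real (card {(a, b) \<in> A \<times> B. gcd a b = d})) + real (N * M) / real D"
proof -
  define F where "F d = {(a, b) \<in> A \<times> B. gcd a b = d}" for d
  have fin: "finite A" "finite B"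
    using A B by (auto intro: finite_subset)
  have finF: "finite (F d)" for d
    using fin by (auto simp: F_def intro: finite_subset[of _ "A \<times> B"])
  have "A \<times> B \<subseteq> (\<Union>d\<in>{1..D}. F d) \<union> (\<Union>d\<in>{D<..N}. F d)"
  proof clarify
    fix a b assume ab: "a \<in> A" "b \<in> B" "(a, b) \<notin> (\<Union>d\<in>{D<..N}. F d)"
    have "1 \<le> a" "a \<le> N"
      using ab A by auto
    then have "1 \<le> gcd a b" "gcd a b \<le> N"
      using gcd_le1_nat[of a b] by (simp add: Suc_le_eq, linarith)
    then show "(a, b) \<in> (\<Union>d\<in>{1..D}. F d)"
      using ab by (force simp: F_def)
  qed
  then have "card (A \<times> B) \<le> card ((\<Union>d\<in>{1..D}. F d) \<union> (\<Union>d\<in>{D<..N}. F d))"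
    using finF by (intro card_mono) auto
  also have "\<dots> \<le> (\<Sum>d=1..D. card (F d)) + (\<Sum>d\<in>{D<..N}. card (F d))"
    by (intro order_trans[OF card_Un_le] add_mono card_UN_le) auto
  finally have "real (card A * card B)
      \<le> (\<Sum>d=1..D. real (card (F d))) + (\<Sum>d\<in>{D<..N}. real (card (F d)))"
    by (simp add: card_cartesian_product flip: of_nat_sum of_nat_add of_nat_mult)
  also have "(\<Sum>d\<in>{D<..N}. real (card (F d))) \<le> (\<Sum>d\<in>{D<..N}. real (N * M) * (1 / (real d)\<^sup>2))"
  proof (rule sum_mono)
    fix d
    have "real (card (F d)) \<le> real (card {a \<in> A. d dvd a}) * real (card {b \<in> B. d dvd b})"
      unfolding F_def of_nat_mult[symmetric] of_nat_le_iff
      by (rule card_gcd_fibre_le_card_multiples[OF fin])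
    also have "\<dots> \<le> (real N / real d) * (real M / real d)"
      using card_multiples_le[OF A] card_multiples_le[OF B] by (intro mult_mono) auto
    finally show "real (card (F d)) \<le> real (N * M) * (1 / (real d)\<^sup>2)"
      by (simp add: power2_eq_square)
  qed
  also have "\<dots> = real (N * M) * (\<Sum>d\<in>{D<..N}. 1 / (real d)\<^sup>2)"
    by (simp add: sum_distrib_left)
  also have "\<dots> \<le> real (N * M) * (1 / real D)"
    by (intro mult_left_mono sum_inverse_squares_tail_le D) simp
  finally show ?thesis by (simp add: F_def)
qed

text \<open>The two bounds for a fibre, \<open>K\<close> and \<open>|A\<^sub>d| |B\<^sub>d|\<close>, are interpolated by their geometric mean, so
  that Cauchy--Schwarz separates \<open>A\<close> from \<open>B\<close>. This is the step where it matters that the pairs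
  form a full product set: for a general set of pairs only the exponent 2 is attainable.\<close>

lemma sum_card_gcd_fibres_squared_le:
  assumes "finite A" "finite B" "0 \<notin> B"
  shows "(\<Sum>d=1..D. real (card {(a, b) \<in> A \<times> B. gcd a b = d}))\<^sup>2
       \<le> real (card (quotient_set A B)) *
         ((\<Sum>d=1..D. real (card {a \<in> A. d dvd a})) * (\<Sum>d=1..D. real (card {b \<in> B. d dvd b})))"
proof -
  define K where "K = real (card (quotient_set A B))"
  define f where "f d = real (card {a \<in> A. d dvd a})" for d
  define g where "g d = real (card {b \<in> B. d dvd b})" for d
  have nonneg: "0 \<le> K" "0 \<le> f d" "0 \<le> g d" for d
    by (simp_all add: K_def f_def g_def)
  have le: "real (card {(a, b) \<in> A \<times> B. gcd a b = d}) \<le> sqrt K * (sqrt (f d) * sqrt (g d))" for d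
  proof -
    define x where "x = real (card {(a, b) \<in> A \<times> B. gcd a b = d})"
    have "x \<le> K" "x \<le> f d * g d"
      unfolding x_def K_def f_def g_def of_nat_mult[symmetric] of_nat_le_iff
      using assms by (rule card_gcd_fibre_le_card_quotient_set)
        (rule card_gcd_fibre_le_card_multiples[OF assms(1,2)])
    then have "x * x \<le> K * (f d * g d)"
      using nonneg by (intro mult_mono) (auto simp: x_def)
    then have "x \<le> sqrt (K * (f d * g d))"
      by (intro real_le_rsqrt) (simp add: power2_eq_square)
    then show ?thesis by (simp add: x_def real_sqrt_mult)
  qed
  have "(\<Sum>d=1..D. real (card {(a, b) \<in> A \<times> B. gcd a b = d}))\<^sup>2
      \<le> (\<Sum>d=1..D. sqrt K * (sqrt (f d) * sqrt (g d)))\<^sup>2"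
    by (intro power_mono sum_mono le sum_nonneg) simp
  also have "\<dots> = K * (\<Sum>d=1..D. sqrt (f d) * sqrt (g d))\<^sup>2"
    using nonneg by (simp add: power_mult_distrib flip: sum_distrib_left)
  also have "\<dots> \<le> K * ((\<Sum>d=1..D. (sqrt (f d))\<^sup>2) * (\<Sum>d=1..D. (sqrt (g d))\<^sup>2))"
    by (intro mult_left_mono Cauchy_Schwarz_ineq_sum nonneg)
  finally show ?thesis
    using nonneg by (simp add: K_def f_def g_def)
qed

section \<open>The quotient set\<close>

lemma power_le_fact_mult_exp:
  fixes x :: real
  assumes "0 \<le> x"
  shows "x ^ m \<le> fact m * exp x"
proof -
  have "(\<Sum>n\<in>{m}. x ^ n /\<^sub>R fact n) \<le> exp x"
    unfolding exp_def using assms by (intro sum_le_suminf summable_exp_generic) auto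
  then show ?thesis by (simp add: field_simps)
qed

text \<open>Any fixed power of \<open>log D\<close> is absorbed by a single factor \<open>D\<close>. This crude bound suffices
  because it enters only through its \<open>k\<close>-th root.\<close>

lemma harm_power_le:
  assumes "1 \<le> D"
  shows "harm D ^ m \<le> fact m * exp 1 * real D"
proof -
  obtain n where n: "D = Suc n"
    using assms by (cases D) auto
  have "harm (Suc n) - ln (real (Suc n)) \<le> harm (Suc 0) - ln (real (Suc 0))"
    using decseqD[OF decseq_harm_diff_ln, of 0 n] by simp
  then have "harm D \<le> 1 + ln (real D)"
    by (simp add: n harm_expand)
  then have "harm D ^ m \<le> (1 + ln (real D)) ^ m"
    by (intro power_mono) (auto simp: harm_nonneg)
  also have "\<dots> \<le> fact m * exp (1 + ln (real D))"
    using assms by (intro power_le_fact_mult_exp) simp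
  also have "\<dots> = fact m * exp 1 * real D"
    using assms by (simp add: exp_add)
  finally show ?thesis .
qed

text \<open>Dividing by \<open>Q\<^sup>2\<close> with \<open>Q = N * M\<close> and \<open>\<delta> = P / Q\<close>, and taking \<open>k\<close>-th roots, this bounds
  \<open>|A/B|\<close> from below by a constant times \<open>\<delta> powr (1 + 2/k) * Q\<close>. Of the loss \<open>2/k\<close>, one half comes from the power
  mean inequality and the other from bounding logarithms of \<open>D\<close> by \<open>D\<close>.\<close>

lemma card_quotient_set_power_ge:
  assumes A: "A \<subseteq> {1..N}" "A \<noteq> {}" and B: "B \<subseteq> {1..M}" "B \<noteq> {}" and k: "even k" "k > 0"
  defines "P \<equiv> real (card A * card B)"
  shows "P ^ (k + 2) \<le> (3 * fact (2 ^ (k + 1)) * exp 1 * 4 ^ k)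
           * real (card (quotient_set A B)) ^ k * real (N * M) ^ 2"
proof -
  define K where "K = real (card (quotient_set A B))"
  define Q where "Q = real (N * M)"
  define D where "D = nat \<lceil>2 * Q / P\<rceil>"
  define SA where "SA = (\<Sum>d=1..D. real (card {a \<in> A. d dvd a}))"
  define SB where "SB = (\<Sum>d=1..D. real (card {b \<in> B. d dvd b}))"
  define h where "h = (harm D :: real)"
  define C where "C = (fact (2 ^ (k + 1)) * exp 1 :: real)"
  have fin: "finite A" "finite B"
    using A B by (auto intro: finite_subset)
  have P: "P > 0"
    using A B fin by (simp add: P_def card_gt_0_iff)
  have "card A \<le> N" "card B \<le> M"
    using A B card_mono[of "{1..N}" A] card_mono[of "{1..M}" B] by auto
  then have PQ: "P \<le> Q"
    unfolding P_def Q_def of_nat_le_iff by (rule mult_mono) auto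
  then have Q: "Q > 0" using P by simp
  have D_ge: "2 * Q / P \<le> real D"
    unfolding D_def by linarith
  have "real D \<le> 2 * Q / P + 1"
    using P Q by (simp add: D_def)
  also have "1 \<le> Q / P" using PQ P by simp
  finally have D_le: "real D \<le> 3 * (Q / P)" by simp
  have "0 < 2 * Q / P" using P Q by simp
  then have "0 < real D" using D_ge by linarith
  then have D1: "1 \<le> D" by simp
  have nonneg: "0 \<le> K" "0 \<le> SA" "0 \<le> SB" "0 \<le> h" "0 \<le> C"
    by (simp_all add: K_def SA_def SB_def h_def C_def sum_nonneg harm_nonneg)

  \<comment> \<open>\<open>D\<close> is just large enough that pairs with gcd above \<open>D\<close> are at most half of all pairs.\<close>
  have "Q / real D \<le> P / 2"
    using D_ge P \<open>0 < real D\<close> by (simp add: field_simps)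
  then have "P / 2 \<le> (\<Sum>d=1..D. real (card {(a, b) \<in> A \<times> B. gcd a b = d}))"
    using card_product_le_sum_card_gcd_fibres[OF A(1) B(1) D1, folded P_def Q_def] by linarith
  then have "(P / 2)\<^sup>2 \<le> (\<Sum>d=1..D. real (card {(a, b) \<in> A \<times> B. gcd a b = d}))\<^sup>2"
    using P by (intro power_mono) auto
  also have "\<dots> \<le> K * (SA * SB)"
    unfolding K_def SA_def SB_def
    by (rule sum_card_gcd_fibres_squared_le[OF fin]) (use B in auto)
  finally have "P\<^sup>2 \<le> (4 * K) * (SA * SB)"
    by (simp add: power_divide)
  then have "(P\<^sup>2) ^ k \<le> ((4 * K) * (SA * SB)) ^ k"
    by (rule power_mono) simp
  then have "(P\<^sup>2) ^ k \<le> (4 * K) ^ k * (SA ^ k * SB ^ k)"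
    by (simp add: power_mult_distrib)
  also have "\<dots> \<le> (4 * K) ^ k * ((real (card A) ^ (k - 1) * (real N * h ^ (2 ^ k)))
      * (real (card B) ^ (k - 1) * (real M * h ^ (2 ^ k))))"
    unfolding SA_def SB_def h_def
    using sum_card_multiples_power_le[OF A(1) k D1] sum_card_multiples_power_le[OF B(1) k D1]
    by (intro mult_left_mono mult_mono) (auto simp: K_def harm_nonneg sum_nonneg)
  also have "\<dots> = (4 * K) ^ k * P ^ (k - 1) * Q * (h ^ (2 ^ k) * h ^ (2 ^ k))"
    by (simp add: P_def Q_def power_mult_distrib mult_ac)
  also have "h ^ (2 ^ k) * h ^ (2 ^ k) = h ^ (2 ^ (k + 1))"
    by (simp flip: power_add add: mult_2)
  also have "(4 * K) ^ k * P ^ (k - 1) * Q * h ^ (2 ^ (k + 1))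
      \<le> (4 * K) ^ k * P ^ (k - 1) * Q * (C * (3 * (Q / P)))"
  proof (rule mult_left_mono)
    have "h ^ (2 ^ (k + 1)) \<le> C * real D"
      unfolding h_def C_def by (rule harm_power_le[OF D1])
    also have "\<dots> \<le> C * (3 * (Q / P))"
      by (intro mult_left_mono D_le nonneg)
    finally show "h ^ (2 ^ (k + 1)) \<le> C * (3 * (Q / P))" .
  qed (use nonneg P Q in auto)
  finally have main: "(P\<^sup>2) ^ k \<le> (4 * K) ^ k * P ^ (k - 1) * Q * (C * (3 * (Q / P)))" .
  \<comment> \<open>It remains to cancel \<open>P ^ (k - 1)\<close> after clearing the denominator \<open>P\<close>.\<close>
  obtain j where j: "k = Suc j" using k(2) by (cases k) auto
  have "P ^ (k + 2) * P ^ j = (P\<^sup>2) ^ k * P"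
    by (simp add: j mult_2 flip: power_mult power_add power_Suc2 del: power_Suc)
  also have "\<dots> \<le> ((4 * K) ^ k * P ^ (k - 1) * Q * (C * (3 * (Q / P)))) * P"
    using main P by (intro mult_right_mono) auto
  also have "\<dots> = (3 * C * 4 ^ k * K ^ k * Q ^ 2) * P ^ j"
    using P by (simp add: j power2_eq_square power_mult_distrib)
  finally have "P ^ (k + 2) \<le> 3 * C * 4 ^ k * K ^ k * Q ^ 2"
    using P by simp
  then show ?thesis
    by (simp add: C_def K_def Q_def mult_ac)
qed

theorem theorem1p1:
  shows "\<forall>\<epsilon>::real. \<epsilon> > 0 \<longrightarrow> (\<exists>c::real. c > 0 \<and>
    (\<forall>(\<alpha>::real) (\<beta>::real) (X::real) (Y::real) (A::nat set) (B::nat set).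
       0 < \<alpha> \<and> \<alpha> \<le> 1 \<and> 0 < \<beta> \<and> \<beta> \<le> 1 \<and> 1 \<le> X \<and> 1 \<le> Y \<and>
       A \<subseteq> {n. 1 \<le> n \<and> real n \<le> X} \<and> B \<subseteq> {n. 1 \<le> n \<and> real n \<le> Y} \<and>
       real (card A) \<ge> \<alpha> * X \<and> real (card B) \<ge> \<beta> * Y
       \<longrightarrow> real (card (quotient_set A B)) \<ge> c * (\<alpha> * \<beta>) powr (1 + \<epsilon>) * X * Y))"
proof (intro allI impI)
  fix \<epsilon> :: real assume eps: "\<epsilon> > 0"
  \<comment> \<open>Twice a natural number that is at least \<open>1 / \<epsilon>\<close>, so that \<open>k\<close> is even and \<open>2 / k \<le> \<epsilon>\<close>.\<close>
  define k where "k = 2 * nat \<lceil>1 / \<epsilon>\<rceil>"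
  have inv: "0 < 1 / \<epsilon>" using eps by simp
  have k: "even k" "k > 0"
    using inv by (simp_all add: k_def)
  have "1 / \<epsilon> \<le> real (nat \<lceil>1 / \<epsilon>\<rceil>)" by linarith
  then have "1 \<le> real (nat \<lceil>1 / \<epsilon>\<rceil>) * \<epsilon>"
    using eps by (subst (asm) pos_divide_le_eq)
  then have k_eps: "2 \<le> real k * \<epsilon>"
    unfolding k_def by simp
  define C where "C = (3 * fact (2 ^ (k + 1)) * exp 1 * 4 ^ k :: real)"
  have C: "C > 0" by (simp add: C_def)
  define c where "c = root k (1 / C)"
  have c: "c > 0" "c ^ k = 1 / C"
    using C k by (simp_all add: c_def)
  show "\<exists>c::real. c > 0 \<and>
    (\<forall>(\<alpha>::real) (\<beta>::real) (X::real) (Y::real) (A::nat set) (B::nat set).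
       0 < \<alpha> \<and> \<alpha> \<le> 1 \<and> 0 < \<beta> \<and> \<beta> \<le> 1 \<and> 1 \<le> X \<and> 1 \<le> Y \<and>
       A \<subseteq> {n. 1 \<le> n \<and> real n \<le> X} \<and> B \<subseteq> {n. 1 \<le> n \<and> real n \<le> Y} \<and>
       real (card A) \<ge> \<alpha> * X \<and> real (card B) \<ge> \<beta> * Y
       \<longrightarrow> real (card (quotient_set A B)) \<ge> c * (\<alpha> * \<beta>) powr (1 + \<epsilon>) * X * Y)"
  proof (intro exI[of _ c] conjI allI impI c(1), elim conjE)
    fix \<alpha> \<beta> X Y :: real and A B :: "nat set"
    assume ab: "0 < \<alpha>" "\<alpha> \<le> 1" "0 < \<beta>" "\<beta> \<le> 1" and XY: "1 \<le> X" "1 \<le> Y"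
      and A: "A \<subseteq> {n. 1 \<le> n \<and> real n \<le> X}" and B: "B \<subseteq> {n. 1 \<le> n \<and> real n \<le> Y}"
      and cA: "real (card A) \<ge> \<alpha> * X" and cB: "real (card B) \<ge> \<beta> * Y"
    define N where "N = nat \<lfloor>X\<rfloor>"
    define M where "M = nat \<lfloor>Y\<rfloor>"
    define K where "K = real (card (quotient_set A B))"
    define \<delta> where "\<delta> = \<alpha> * \<beta>"
    have \<delta>: "0 < \<delta>" "\<delta> \<le> 1"
      using ab by (simp_all add: \<delta>_def mult_le_one)
    have AN: "A \<subseteq> {1..N}" and BM: "B \<subseteq> {1..M}"
      using A B by (auto simp: N_def M_def le_nat_floor)
    have "0 < \<alpha> * X" "0 < \<beta> * Y" using ab XY by simp_all
    then have "0 < real (card A)" "0 < real (card B)"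
      using cA cB by linarith+
    then have ne: "A \<noteq> {}" "B \<noteq> {}" by auto
    have NX: "real N \<le> X" and MY: "real M \<le> Y"
      using XY by (simp_all add: N_def M_def)
    have "\<delta> * (X * Y) = (\<alpha> * X) * (\<beta> * Y)"
      by (simp add: \<delta>_def)
    also have "\<dots> \<le> real (card A * card B)"
      unfolding of_nat_mult using ab XY by (intro mult_mono cA cB) auto
    finally have "(\<delta> * (X * Y)) ^ (k + 2) \<le> real (card A * card B) ^ (k + 2)"
      using \<delta> XY by (intro power_mono) auto
    also have "\<dots> \<le> C * K ^ k * real (N * M) ^ 2"
      unfolding C_def K_def by (rule card_quotient_set_power_ge[OF AN ne(1) BM ne(2) k])
    also have "\<dots> \<le> C * K ^ k * (X * Y) ^ 2"
      unfolding of_nat_mult using NX MY C XY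
      by (intro mult_left_mono power_mono mult_mono) (auto simp: K_def)
    finally have "(\<delta> ^ (k + 2) * (X * Y) ^ k) * (X * Y) ^ 2 \<le> (C * K ^ k) * (X * Y) ^ 2"
      by (simp only: power_mult_distrib power_add mult_ac)
    then have *: "\<delta> ^ (k + 2) * (X * Y) ^ k \<le> C * K ^ k"
      using XY by (subst (asm) mult_le_cancel_right_pos) auto
    \<comment> \<open>As \<open>\<delta> \<le> 1\<close>, the larger exponent \<open>k * (1 + \<epsilon>) \<ge> k + 2\<close> gives the smaller power.\<close>
    have "(\<delta> powr (1 + \<epsilon>)) ^ k = \<delta> powr ((1 + \<epsilon>) * real k)"
      using \<delta> by (simp add: powr_powr flip: powr_realpow)
    also have "\<dots> \<le> \<delta> powr real (k + 2)"
      using \<delta> k_eps by (intro powr_mono') (auto simp: algebra_simps)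
    also have "\<dots> = \<delta> ^ (k + 2)"
      using \<delta> by (simp only: powr_realpow)
    finally have "(\<delta> powr (1 + \<epsilon>)) ^ k * (X * Y) ^ k \<le> \<delta> ^ (k + 2) * (X * Y) ^ k"
      using XY by (intro mult_right_mono) auto
    also note *
    finally have "((\<delta> powr (1 + \<epsilon>)) ^ k * (X * Y) ^ k) / C \<le> K ^ k"
      using C by (simp add: pos_divide_le_eq mult.commute)
    also have "((\<delta> powr (1 + \<epsilon>)) ^ k * (X * Y) ^ k) / C = (c * \<delta> powr (1 + \<epsilon>) * X * Y) ^ k"
      by (simp add: power_mult_distrib c(2))
    finally have "c * \<delta> powr (1 + \<epsilon>) * X * Y \<le> K"
      using k(2) c(1) XY by (subst (asm) power_mono_iff) (auto simp: K_def)
    then show "c * (\<alpha> * \<beta>) powr (1 + \<epsilon>) * X * Y \<le> real (card (quotient_set A B))"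
      by (simp add: K_def \<delta>_def)
  qed
qed

end
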